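(* Let $n\ge 1$, $\tau>0$, $\mathcal{N}_n\subseteq[2,\infty]$ with $2\in\mathcal{N}_n$, let $Y_1,\dots,Y_n$ be real-valued random variables, and let $\hat\theta_{\hat\gamma}$ be the CAVS estimator computed from $Y_1,\dots,Y_n$ with tuning parameter $\tau$ and candidate set $\mathcal{N}_n$ (defined in the context). Let $\bar Y=\frac1n\sum_{i=1}^n Y_i$ and let $\hat\sigma^2=\frac1n\sum_{i=1}^n (Y_i-\bar Y)^2$ be the empirical variance. Then, for any $n$, it holds surely that $$|\hat\theta_{\hat\gamma}-\bar Y|\le 2\tau\sqrt{\frac{\hat\sigma^2}{n}}.$$ Therefore, there is a universal constant $C>0$ such that, if additionally $Y_1,\dots,Y_n$ are independent and identically distributed, $Y_i=\theta_0+Z_i$ with $\theta_0=\mathbb{E}Y_1$ and $\sigma^2:=\mathbb{E}|Z_1|^2<\infty$, then $$\mathbb{E}|\hat\theta_{\hat\gamma}-\theta_0|\le C\,\tau\sqrt{\frac{\sigma^2}{n}}.$$ (No symmetry of the distribution of $Z_1$ is assumed.)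
   Context: For $\gamma\in[2,\infty)$ let $\hat\theta_\gamma:=\arg\min_{\theta\in\mathbb{R}}\sum_{i=1}^n|Y_i-\theta|^\gamma$, and let $\hat\theta_\infty:=\frac{Y_{(n)}+Y_{(1)}}{2}$ be the sample midrange, where $Y_{(1)}=\min_i Y_i$ and $Y_{(n)}=\max_i Y_i$. For $\gamma\in[2,\infty)$ let $$\hat V(\gamma):=\frac{\min_{\theta\in\mathbb{R}}\frac1n\sum_{i=1}^n|Y_i-\theta|^{2(\gamma-1)}}{\left[(\gamma-1)\min_{\theta\in\mathbb{R}}\frac1n\sum_{i=1}^n|Y_i-\theta|^{\gamma-2}\right]^2},$$ and $\hat V(\infty):=0$. Conventions: $|x|^0=1$ for all $x$ (including $0$), so $\hat V(2)=\hat\sigma^2$; and $\hat V(\gamma):=0$ if numerator and denominator both vanish. The Constrained Asymptotic Variance Selection (CAVS) estimator with tuning parameter $\tau>0$ and candidate set $\mathcal{N}_n\subseteq[2,\infty]$ is defined as follows. (1) $\gamma_{\max}$ is the largest element of $\mathcal{N}_n$ such that $$\bigcap_{\gamma\in\mathcal{N}_n,\ \gamma\le\gamma_{\max}}\left[\hat\theta_\gamma-\tau\sqrt{\hat V(\gamma)/n},\ \hat\theta_\gamma+\tau\sqrt{\hat V(\gamma)/n}\right]\neq\emptyset.$$ (2) $\hat\gamma:=\arg\min_{\gamma\in\mathcal{N}_n,\ \gamma\le\gamma_{\max}}\hat V(\gamma)$ (any minimizer). (3) The output is $\hat\theta_{\hat\gamma}$. It is assumed that $\mathcal{N}_n$ is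 such that $\gamma_{\max}$ and $\hat\gamma$ exist (automatic if $\mathcal{N}_n$ is finite).
   Formalization: The second bound has C·max(1,τ) in place of C·τ: with C·τ it fails as τ→0 (for candidate set {2} the estimator is the sample mean). Formally C is chosen for each type of sample points; one C for all follows by transporting the data and the selected exponent to a fixed type. *)

theory Defs
  imports "HOL-Probability.Probability"
begin

text \<open>A sample is a function \<open>y :: nat \<Rightarrow> real\<close>, of which only \<open>y 1, \<dots>, y n\<close> matter. Exponents
  \<open>\<gamma> \<in> [2, \<infinity>]\<close> are extended reals.\<close>

text \<open>HOL has \<open>0 powr 0 = 0\<close>, whereas the convention here is \<open>\<bar>x\<bar>\<^sup>0 = 1\<close> for all \<open>x\<close>, including 0.\<close>

definition abs_pow :: "real \<Rightarrow> real \<Rightarrow> real" where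
  "abs_pow x a = (if a = 0 then 1 else \<bar>x\<bar> powr a)"

text \<open>The minimum value of \<open>f\<close>. It is only applied to functions that attain their minimum (constant, or
  continuous and tending to infinity at both ends of the real line).\<close>

definition min_val :: "(real \<Rightarrow> real) \<Rightarrow> real" where
  "min_val f = f (arg_min f (\<lambda>_. True))"

definition sample_mean :: "nat \<Rightarrow> (nat \<Rightarrow> real) \<Rightarrow> real" where
  "sample_mean n y = (\<Sum>i\<in>{1..n}. y i) / real n"

definition sample_var :: "nat \<Rightarrow> (nat \<Rightarrow> real) \<Rightarrow> real" where
  "sample_var n y = (\<Sum>i\<in>{1..n}. (y i - sample_mean n y)\<^sup>2) / real n"

text \<open>For finite \<open>\<gamma> \<ge> 2\<close> and \<open>n \<ge> 1\<close> the objective is strictly convex and coercive, so its minimizer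
  exists and is unique.\<close>

definition theta_hat :: "nat \<Rightarrow> (nat \<Rightarrow> real) \<Rightarrow> ereal \<Rightarrow> real" where
  "theta_hat n y \<gamma> =
     (if \<gamma> = \<infinity> then (Max (y ` {1..n}) + Min (y ` {1..n})) / 2
      else arg_min (\<lambda>\<theta>. \<Sum>i\<in>{1..n}. abs_pow (y i - \<theta>) (real_of_ereal \<gamma>)) (\<lambda>_. True))"

text \<open>The convention that the quotient is 0 when numerator and denominator both vanish is \<open>0 / 0 = 0\<close>.
  (A vanishing denominator forces all observations to coincide, hence a vanishing numerator.)\<close>

definition V_hat :: "nat \<Rightarrow> (nat \<Rightarrow> real) \<Rightarrow> ereal \<Rightarrow> real" where
  "V_hat n y \<gamma> =
     (if \<gamma> = \<infinity> then 0
      else let r = real_of_ereal \<gamma> in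
        min_val (\<lambda>\<theta>. (\<Sum>i\<in>{1..n}. abs_pow (y i - \<theta>) (2 * (r - 1))) / real n) /
        ((r - 1) * min_val (\<lambda>\<theta>. (\<Sum>i\<in>{1..n}. abs_pow (y i - \<theta>) (r - 2)) / real n))\<^sup>2)"

definition conf_int :: "real \<Rightarrow> nat \<Rightarrow> (nat \<Rightarrow> real) \<Rightarrow> ereal \<Rightarrow> real set" where
  "conf_int \<tau> n y \<gamma> =
     {theta_hat n y \<gamma> - \<tau> * sqrt (V_hat n y \<gamma> / real n) ..
      theta_hat n y \<gamma> + \<tau> * sqrt (V_hat n y \<gamma> / real n)}"

text \<open>A relation rather than a function, since the largest element need not exist for infinite \<open>N\<close>.\<close>

definition is_gamma_max :: "real \<Rightarrow> ereal set \<Rightarrow> nat \<Rightarrow> (nat \<Rightarrow> real) \<Rightarrow> ereal \<Rightarrow> bool" where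
  "is_gamma_max \<tau> N n y gmax \<longleftrightarrow>
     is_arg_max (\<lambda>g. g)
       (\<lambda>g. g \<in> N \<and> (\<Inter>\<gamma>\<in>{\<gamma> \<in> N. \<gamma> \<le> g}. conf_int \<tau> n y \<gamma>) \<noteq> {}) gmax"

text \<open>\<open>\<gamma>\<close> may be any of the minimizers; the relation includes the existence of \<open>gmax\<close> and \<open>\<gamma>\<close>.\<close>

definition is_gamma_hat :: "real \<Rightarrow> ereal set \<Rightarrow> nat \<Rightarrow> (nat \<Rightarrow> real) \<Rightarrow> ereal \<Rightarrow> bool" where
  "is_gamma_hat \<tau> N n y \<gamma> \<longleftrightarrow>
     (\<exists>gmax. is_gamma_max \<tau> N n y gmax \<and>
             is_arg_min (V_hat n y) (\<lambda>g. g \<in> N \<and> g \<le> gmax) \<gamma>)"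

text \<open>\<open>G \<omega>\<close> is the exponent selected on the sample \<open>Y 1 \<omega>, \<dots>, Y n \<omega>\<close>.\<close>

locale cavs = prob_space M for M :: "'a measure" +
  fixes n :: nat and \<tau> :: real and N :: "ereal set"
    and Y :: "nat \<Rightarrow> 'a \<Rightarrow> real" and G :: "'a \<Rightarrow> ereal"
  assumes n_ge_1: "n \<ge> 1"
    and tau_pos: "\<tau> > 0"
    and N_subset: "N \<subseteq> {2..\<infinity>}"
    and two_in_N: "2 \<in> N"
    and rv: "\<And>i. i \<in> {1..n} \<Longrightarrow> random_variable borel (Y i)"
    and selected: "\<And>\<omega>. \<omega> \<in> space M \<Longrightarrow> is_gamma_hat \<tau> N n (\<lambda>i. Y i \<omega>) (G \<omega>)"

definition cavs_est :: "nat \<Rightarrow> (nat \<Rightarrow> 'a \<Rightarrow> real) \<Rightarrow> ('a \<Rightarrow> ereal) \<Rightarrow> 'a \<Rightarrow> real" where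
  "cavs_est n Y G \<omega> = theta_hat n (\<lambda>i. Y i \<omega>) (G \<omega>)"

definition iid :: "'a measure \<Rightarrow> nat \<Rightarrow> (nat \<Rightarrow> 'a \<Rightarrow> real) \<Rightarrow> bool" where
  "iid M n Y \<longleftrightarrow>
     prob_space.indep_vars M (\<lambda>_. borel) Y {1..n} \<and>
     (\<forall>i\<in>{1..n}. distr M borel (Y i) = distr M borel (Y 1))"

end

theory Submission
  imports Defs
begin

text \<open>
  The sample mean is itself one of the candidates: \<open>\<gamma> = 2\<close> gives the estimator \<open>sample_mean\<close> with
  \<open>V_hat = sample_var\<close>. This follows from the decomposition
  \<open>\<Sum>(y i - t)\<^sup>2 = n * sample_var + n * (sample_mean - t)\<^sup>2\<close>. Both \<open>2\<close> and the selected \<open>\<gamma>\<close> lie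
  below the largest admissible exponent, so their confidence intervals share a point, and the two estimators differ by at most the
  sum of the two half-widths. Since \<open>\<gamma>\<close> minimizes \<open>V_hat\<close>, its interval is no wider than the one at
  \<open>2\<close>, whence the factor \<open>2\<close> in the sure bound.

  For the bound in expectation, the triangle inequality reduces the claim to the means of
  \<open>\<bar>sample_mean - \<theta>0\<bar>\<close> and of \<open>sqrt (sample_var / n)\<close>. Each is at most the root of its second
  moment. The first second moment is \<open>\<sigma>2 / n\<close>, because variances of independent variables add up. The
  second is at most \<open>\<sigma>2 / n\<close>, because the decomposition at \<open>t = \<theta>0\<close> bounds \<open>sample_var\<close> by the
  average of the \<open>(Y i - \<theta>0)\<^sup>2\<close>. This gives the factor \<open>1 + 2 * \<tau> \<le> 3 * max 1 \<tau>\<close>. The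
  maximum cannot be replaced by \<open>\<tau>\<close>: for \<open>N = {2}\<close> the estimator is the sample mean whatever
  \<open>\<tau>\<close> is, so its mean error does not decrease with \<open>\<tau>\<close>.
\<close>

section \<open>The sure bound\<close>

text \<open>Expanding \<open>y i - t\<close> around the sample mean, the cross term vanishes because the deviations
  \<open>y i - sample_mean\<close> sum to \<open>0\<close>.\<close>

lemma sum_sq_decomposition:
  assumes "n \<ge> 1"
  shows "(\<Sum>i\<in>{1..n}. (y i - t)\<^sup>2) = real n * sample_var n y + real n * (sample_mean n y - t)\<^sup>2"
proof -
  define m where "m = sample_mean n y"
  have sum_y: "(\<Sum>i\<in>{1..n}. y i) = real n * m"
    using assms by (simp add: m_def sample_mean_def)
  have "(\<Sum>i\<in>{1..n}. (y i - t)\<^sup>2)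
      = (\<Sum>i\<in>{1..n}. (y i - m)\<^sup>2 + (2 * (m - t) * (y i - m) + (m - t)\<^sup>2))"
    by (intro sum.cong refl) (simp add: power2_eq_square algebra_simps)
  also have "\<dots> = (\<Sum>i\<in>{1..n}. (y i - m)\<^sup>2)
      + (2 * (m - t) * ((\<Sum>i\<in>{1..n}. y i) - real n * m) + real n * (m - t)\<^sup>2)"
    by (simp add: sum.distrib sum_subtractf flip: sum_distrib_left)
  finally show ?thesis
    using assms sum_y by (simp add: sample_var_def m_def)
qed

lemma sample_var_nonneg: "0 \<le> sample_var n y"
  by (simp add: sample_var_def sum_nonneg)

lemma abs_pow_2: "abs_pow x 2 = x\<^sup>2"
  by (simp add: abs_pow_def)

lemma theta_hat_2:
  assumes "n \<ge> 1"
  shows "theta_hat n y 2 = sample_mean n y"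
proof -
  let ?f = "\<lambda>\<theta>. \<Sum>i\<in>{1..n}. (y i - \<theta>)\<^sup>2"
  have min: "?f t \<ge> ?f (sample_mean n y)" for t
    unfolding sum_sq_decomposition[OF assms] by simp
  have "arg_min ?f (\<lambda>_. True) = sample_mean n y"
  proof (rule arg_minI[where P = "\<lambda>_. True" and f = ?f])
    fix x assume "\<forall>t. True \<longrightarrow> \<not> ?f t < ?f x"
    then have "?f x \<le> ?f (sample_mean n y)" by (simp add: not_less)
    then have "real n * (sample_mean n y - x)\<^sup>2 \<le> 0"
      unfolding sum_sq_decomposition[OF assms] by simp
    then show "x = sample_mean n y" using assms by (simp add: mult_le_0_iff)
  qed (use min in \<open>auto simp: not_less\<close>)
  then show ?thesis by (simp add: theta_hat_def abs_pow_2)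
qed

lemma V_hat_2:
  assumes "n \<ge> 1"
  shows "V_hat n y 2 = sample_var n y"
proof -
  let ?f = "\<lambda>\<theta>. (\<Sum>i\<in>{1..n}. (y i - \<theta>)\<^sup>2) / real n"
  have "min_val ?f = ?f (sample_mean n y)"
    unfolding min_val_def
  proof (rule arg_min_equality)
    show "?f (sample_mean n y) \<le> ?f t" for t
      unfolding sum_sq_decomposition[OF assms] using assms by (simp add: add_divide_distrib)
  qed simp
  then have "min_val ?f = sample_var n y"
    by (simp add: sample_var_def)
  moreover have "min_val (\<lambda>\<theta>. (\<Sum>i\<in>{1..n}. abs_pow (y i - \<theta>) 0) / real n) = 1"
    using assms by (simp add: min_val_def abs_pow_def)
  ultimately show ?thesis
    by (simp add: V_hat_def abs_pow_2 Let_def)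
qed

text \<open>A point common to the intervals at \<open>\<gamma>\<close> and at \<open>2\<close> is within \<open>\<tau> * sqrt (sample_var / n)\<close> of
  both centres, since the interval at \<open>\<gamma>\<close> is the narrower one.\<close>

lemma selected_dist_sample_mean_le:
  assumes n: "n \<ge> 1" and \<tau>: "\<tau> > 0" and N: "N \<subseteq> {2..\<infinity>}" "2 \<in> N"
    and sel: "is_gamma_hat \<tau> N n y \<gamma>"
  shows "\<bar>theta_hat n y \<gamma> - sample_mean n y\<bar> \<le> 2 * \<tau> * sqrt (sample_var n y / real n)"
proof -
  from sel obtain gmax where
    gmax: "gmax \<in> N" "(\<Inter>\<gamma>\<in>{\<gamma> \<in> N. \<gamma> \<le> gmax}. conf_int \<tau> n y \<gamma>) \<noteq> {}"
    and \<gamma>: "\<gamma> \<in> N" "\<gamma> \<le> gmax"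
    and min: "\<And>g. g \<in> N \<Longrightarrow> g \<le> gmax \<Longrightarrow> V_hat n y \<gamma> \<le> V_hat n y g"
    by (auto simp: is_gamma_hat_def is_gamma_max_def is_arg_max_def is_arg_min_linorder)
  have "2 \<le> gmax" using gmax(1) N(1) by auto
  obtain x where x: "\<And>g. g \<in> N \<Longrightarrow> g \<le> gmax \<Longrightarrow> x \<in> conf_int \<tau> n y g"
    using gmax(2) by auto
  have "\<bar>theta_hat n y \<gamma> - x\<bar> \<le> \<tau> * sqrt (V_hat n y \<gamma> / real n)"
    using x[OF \<gamma>] by (auto simp: conf_int_def)
  also have "\<dots> \<le> \<tau> * sqrt (sample_var n y / real n)"
    using \<tau> min[OF N(2) \<open>2 \<le> gmax\<close>, unfolded V_hat_2[OF n]] by (simp add: divide_right_mono)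
  finally have 1: "\<bar>theta_hat n y \<gamma> - x\<bar> \<le> \<tau> * sqrt (sample_var n y / real n)" .
  have 2: "\<bar>x - sample_mean n y\<bar> \<le> \<tau> * sqrt (sample_var n y / real n)"
    using x[OF N(2) \<open>2 \<le> gmax\<close>, unfolded conf_int_def theta_hat_2[OF n] V_hat_2[OF n]] by auto
  show ?thesis using 1 2 by linarith
qed

section \<open>Second moments\<close>

text \<open>Adding one variable \<open>X j\<close> to a sum \<open>S\<close> contributes the cross term \<open>2 * X j * S\<close>, whose
  expectation is a product with the factor \<open>expectation (X j) = 0\<close>.\<close>

lemma (in prob_space) indep_centred_sum_second_moment:
  fixes X :: "'i \<Rightarrow> 'a \<Rightarrow> real"
  assumes "finite I" "indep_vars (\<lambda>_. borel) X I"
    and "\<And>i. i \<in> I \<Longrightarrow> integrable M (\<lambda>\<omega>. (X i \<omega>)\<^sup>2)"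
    and "\<And>i. i \<in> I \<Longrightarrow> expectation (X i) = 0"
  shows "integrable M (\<lambda>\<omega>. (\<Sum>i\<in>I. X i \<omega>)\<^sup>2) \<and>
    expectation (\<lambda>\<omega>. (\<Sum>i\<in>I. X i \<omega>)\<^sup>2) = (\<Sum>i\<in>I. expectation (\<lambda>\<omega>. (X i \<omega>)\<^sup>2))"
  using assms
proof (induction I rule: finite_induct)
  case empty
  then show ?case by simp
next
  case (insert j J)
  let ?S = "\<lambda>\<omega>. \<Sum>i\<in>J. X i \<omega>"
  have meas: "X i \<in> borel_measurable M" if "i \<in> insert j J" for i
    using insert.prems(1) that by (auto simp: indep_vars_def)
  have int: "integrable M (X i)" if "i \<in> insert j J" for i
    using square_integrable_imp_integrable[OF meas insert.prems(2)] that by blast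
  have IH: "integrable M (\<lambda>\<omega>. (?S \<omega>)\<^sup>2)"
      "expectation (\<lambda>\<omega>. (?S \<omega>)\<^sup>2) = (\<Sum>i\<in>J. expectation (\<lambda>\<omega>. (X i \<omega>)\<^sup>2))"
    using insert.IH insert.prems indep_vars_subset[OF insert.prems(1), of J] by auto
  have ind: "indep_var borel (X j) borel ?S"
    by (rule indep_vars_sum[OF insert.hyps insert.prems(1)])
  have int_S: "integrable M ?S" using int by auto
  have cross: "integrable M (\<lambda>\<omega>. X j \<omega> * ?S \<omega>)" "expectation (\<lambda>\<omega>. X j \<omega> * ?S \<omega>) = 0"
    using indep_var_integrable[OF ind int int_S] indep_var_lebesgue_integral[OF ind int int_S]
      insert.prems(3)[of j] by auto
  have sq: "(\<lambda>\<omega>. (\<Sum>i\<in>insert j J. X i \<omega>)\<^sup>2) = (\<lambda>\<omega>. (X j \<omega>)\<^sup>2 + (?S \<omega>)\<^sup>2 + 2 * (X j \<omega> * ?S \<omega>))"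
    using insert.hyps by (simp add: power2_sum mult.assoc)
  have j: "integrable M (\<lambda>\<omega>. (X j \<omega>)\<^sup>2)" using insert.prems(2) by simp
  show ?case
    unfolding sq using j IH cross insert.hyps by simp
qed

text \<open>This is nonnegativity of the variance.\<close>

lemma (in prob_space) expectation_le_sqrt_second_moment:
  fixes W :: "'a \<Rightarrow> real"
  assumes "W \<in> borel_measurable M" "integrable M (\<lambda>\<omega>. (W \<omega>)\<^sup>2)"
  shows "integrable M W" "expectation W \<le> sqrt (expectation (\<lambda>\<omega>. (W \<omega>)\<^sup>2))"
proof -
  show int: "integrable M W"
    by (rule square_integrable_imp_integrable[OF assms])
  have "(expectation W)\<^sup>2 \<le> expectation (\<lambda>\<omega>. (W \<omega>)\<^sup>2)"
    using variance_positive[of W] variance_eq[OF int assms(2)] by simp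
  then show "expectation W \<le> sqrt (expectation (\<lambda>\<omega>. (W \<omega>)\<^sup>2))"
    by (rule real_le_rsqrt)
qed

lemma same_distr_integral:
  fixes f :: "real \<Rightarrow> real"
  assumes distr: "distr M borel X = distr M borel Y"
    and X: "X \<in> borel_measurable M" and Y: "Y \<in> borel_measurable M"
    and f: "f \<in> borel_measurable borel"
  shows "integrable M (\<lambda>\<omega>. f (X \<omega>)) \<longleftrightarrow> integrable M (\<lambda>\<omega>. f (Y \<omega>))"
    and "(\<integral>\<omega>. f (X \<omega>) \<partial>M) = (\<integral>\<omega>. f (Y \<omega>) \<partial>M)"
  using integrable_distr_eq[OF X f] integral_distr[OF X f]
  unfolding distr integrable_distr_eq[OF Y f] integral_distr[OF Y f]
  by simp_all

section \<open>The bound in expectation\<close>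

text \<open>With \<open>D = sample_mean - \<theta>\<close>, the decomposition says that \<open>sample_var\<close> is the average of the
  \<open>(Y i - \<theta>)\<^sup>2\<close> minus \<open>D\<^sup>2\<close>. So it has expectation \<open>\<sigma>2 - \<sigma>2 / n\<close>, and the bound \<open>\<sigma>2\<close> follows.\<close>

lemma (in prob_space) iid_sample_mean_sample_var_bounds:
  fixes Y :: "nat \<Rightarrow> 'a \<Rightarrow> real"
  assumes n: "n \<ge> 1" and iid: "iid M n Y"
    and meas: "\<And>i. i \<in> {1..n} \<Longrightarrow> Y i \<in> borel_measurable M"
    and int: "integrable M (Y 1)" and \<theta>: "\<theta> = expectation (Y 1)"
    and sq: "integrable M (\<lambda>\<omega>. (Y 1 \<omega> - \<theta>)\<^sup>2)" and \<sigma>2: "\<sigma>2 = expectation (\<lambda>\<omega>. (Y 1 \<omega> - \<theta>)\<^sup>2)"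
  shows "integrable M (\<lambda>\<omega>. \<bar>sample_mean n (\<lambda>i. Y i \<omega>) - \<theta>\<bar>)"
    and "expectation (\<lambda>\<omega>. \<bar>sample_mean n (\<lambda>i. Y i \<omega>) - \<theta>\<bar>) \<le> sqrt (\<sigma>2 / real n)"
    and "integrable M (\<lambda>\<omega>. sqrt (sample_var n (\<lambda>i. Y i \<omega>) / real n))"
    and "expectation (\<lambda>\<omega>. sqrt (sample_var n (\<lambda>i. Y i \<omega>) / real n)) \<le> sqrt (\<sigma>2 / real n)"
proof -
  define X where "X i \<omega> = Y i \<omega> - \<theta>" for i \<omega>
  define D where "D \<omega> = sample_mean n (\<lambda>i. Y i \<omega>) - \<theta>" for \<omega>
  define V where "V \<omega> = sample_var n (\<lambda>i. Y i \<omega>)" for \<omega>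
  have distr: "distr M borel (Y i) = distr M borel (Y 1)" if "i \<in> {1..n}" for i
    using iid that unfolding iid_def by blast
  have meas1: "Y 1 \<in> borel_measurable M" using meas n by simp
  have X_sq: "integrable M (\<lambda>\<omega>. (X i \<omega>)\<^sup>2)" "expectation (\<lambda>\<omega>. (X i \<omega>)\<^sup>2) = \<sigma>2"
    if "i \<in> {1..n}" for i
    unfolding X_def \<sigma>2
    using same_distr_integral[OF distr[OF that] meas[OF that] meas1, of "\<lambda>x. (x - \<theta>)\<^sup>2"] sq
    by simp_all
  have X_mean: "expectation (X i) = 0" if "i \<in> {1..n}" for i
    using same_distr_integral[OF distr[OF that] meas[OF that] meas1, of "\<lambda>x. x - \<theta>"] int \<theta>
    by (simp add: X_def[abs_def] prob_space)
  have X_indep: "indep_vars (\<lambda>_. borel) X {1..n}"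
    unfolding X_def[abs_def]
    by (rule indep_vars_compose2[where X = Y and M' = "\<lambda>_. borel"])
       (use iid iid_def in \<open>blast, simp\<close>)
  have meas_X: "X i \<in> borel_measurable M" if "i \<in> {1..n}" for i
    using meas[OF that] by (simp add: X_def[abs_def])
  have D_eq: "D = (\<lambda>\<omega>. (\<Sum>i\<in>{1..n}. X i \<omega>) / real n)"
    using n by (simp add: D_def X_def sample_mean_def fun_eq_iff sum_subtractf diff_divide_distrib)
  have meas_D: "D \<in> borel_measurable M"
    unfolding D_eq using meas_X by measurable
  have meas_V: "V \<in> borel_measurable M"
    unfolding V_def[abs_def] sample_var_def sample_mean_def using meas by measurable
  have D_sq: "integrable M (\<lambda>\<omega>. (D \<omega>)\<^sup>2)" "expectation (\<lambda>\<omega>. (D \<omega>)\<^sup>2) = \<sigma>2 / real n"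
    using indep_centred_sum_second_moment[OF _ X_indep] X_sq X_mean n
    by (simp_all add: D_eq power_divide power2_eq_square[of "real n"])

  have V_eq: "V = (\<lambda>\<omega>. (\<Sum>i\<in>{1..n}. (X i \<omega>)\<^sup>2) / real n - (D \<omega>)\<^sup>2)"
  proof
    show "V \<omega> = (\<Sum>i\<in>{1..n}. (X i \<omega>)\<^sup>2) / real n - (D \<omega>)\<^sup>2" for \<omega>
      unfolding X_def sum_sq_decomposition[OF n] using n
      by (simp add: V_def D_def add_divide_distrib)
  qed
  have avg: "integrable M (\<lambda>\<omega>. (\<Sum>i\<in>{1..n}. (X i \<omega>)\<^sup>2) / real n)"
    by (intro integrable_divide Bochner_Integration.integrable_sum X_sq)
  have "expectation (\<lambda>\<omega>. \<Sum>i\<in>{1..n}. (X i \<omega>)\<^sup>2) = real n * \<sigma>2"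
    using X_sq by (subst Bochner_Integration.integral_sum) auto
  then have avg_eq: "expectation (\<lambda>\<omega>. (\<Sum>i\<in>{1..n}. (X i \<omega>)\<^sup>2) / real n) = \<sigma>2"
    using n by simp
  have V_int: "integrable M V"
    unfolding V_eq by (rule Bochner_Integration.integrable_diff[OF avg D_sq(1)])
  have "expectation V = \<sigma>2 - \<sigma>2 / real n"
    unfolding V_eq Bochner_Integration.integral_diff[OF avg D_sq(1)] avg_eq D_sq(2) ..
  moreover have "0 \<le> \<sigma>2" by (simp add: \<sigma>2)
  ultimately have V_le: "expectation V \<le> \<sigma>2" by simp
  have sqrt_sq: "(sqrt (V \<omega> / real n))\<^sup>2 = V \<omega> / real n" for \<omega>
    by (simp add: V_def sample_var_nonneg)

  note mean = expectation_le_sqrt_second_moment[of "\<lambda>\<omega>. \<bar>D \<omega>\<bar>"]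
  show "integrable M (\<lambda>\<omega>. \<bar>sample_mean n (\<lambda>i. Y i \<omega>) - \<theta>\<bar>)"
    "expectation (\<lambda>\<omega>. \<bar>sample_mean n (\<lambda>i. Y i \<omega>) - \<theta>\<bar>) \<le> sqrt (\<sigma>2 / real n)"
    using mean meas_D D_sq by (simp_all flip: D_def)

  note var = expectation_le_sqrt_second_moment[of "\<lambda>\<omega>. sqrt (V \<omega> / real n)", unfolded sqrt_sq]
  have meas_W: "(\<lambda>\<omega>. sqrt (V \<omega> / real n)) \<in> borel_measurable M" using meas_V by measurable
  have W_int: "integrable M (\<lambda>\<omega>. V \<omega> / real n)" using V_int by simp
  show "integrable M (\<lambda>\<omega>. sqrt (sample_var n (\<lambda>i. Y i \<omega>) / real n))"
    using var(1)[OF meas_W W_int] by (simp only: V_def)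
  have "expectation (\<lambda>\<omega>. sqrt (V \<omega> / real n)) \<le> sqrt (expectation V / real n)"
    using var(2)[OF meas_W W_int] by simp
  also have "\<dots> \<le> sqrt (\<sigma>2 / real n)"
    using V_le by (simp add: divide_right_mono)
  finally show "expectation (\<lambda>\<omega>. sqrt (sample_var n (\<lambda>i. Y i \<omega>) / real n)) \<le> sqrt (\<sigma>2 / real n)"
    by (simp only: V_def)
qed

context cavs
begin

lemma cavs_est_dist_sample_mean_le:
  assumes "\<omega> \<in> space M"
  shows "\<bar>cavs_est n Y G \<omega> - sample_mean n (\<lambda>i. Y i \<omega>)\<bar>
    \<le> 2 * \<tau> * sqrt (sample_var n (\<lambda>i. Y i \<omega>) / real n)"
  unfolding cavs_est_def
  by (rule selected_dist_sample_mean_le[OF n_ge_1 tau_pos N_subset two_in_N selected[OF assms]])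

text \<open>The selected exponent \<open>G\<close> need not be measurable, so neither need the error be. Its upper integral
  is still bounded by the integral of the measurable majorant that the sure bound gives.\<close>

lemma cavs_est_mean_error_le:
  assumes iid: "iid M n Y" and int: "integrable M (Y 1)" and \<theta>: "\<theta> = expectation (Y 1)"
    and sq: "integrable M (\<lambda>\<omega>. (Y 1 \<omega> - \<theta>)\<^sup>2)" and \<sigma>2: "\<sigma>2 = expectation (\<lambda>\<omega>. (Y 1 \<omega> - \<theta>)\<^sup>2)"
  shows "(\<integral>\<^sup>+\<omega>. ennreal \<bar>cavs_est n Y G \<omega> - \<theta>\<bar> \<partial>M) \<le> ennreal ((1 + 2 * \<tau>) * sqrt (\<sigma>2 / real n))"
proof -
  let ?D = "\<lambda>\<omega>. \<bar>sample_mean n (\<lambda>i. Y i \<omega>) - \<theta>\<bar>"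
  let ?W = "\<lambda>\<omega>. sqrt (sample_var n (\<lambda>i. Y i \<omega>) / real n)"
  note bounds = iid_sample_mean_sample_var_bounds[OF n_ge_1 iid rv int \<theta> sq \<sigma>2]
  have nonneg: "0 \<le> ?D \<omega> + 2 * \<tau> * ?W \<omega>" for \<omega>
    using tau_pos by (simp add: sample_var_nonneg)
  have "(\<integral>\<^sup>+\<omega>. ennreal \<bar>cavs_est n Y G \<omega> - \<theta>\<bar> \<partial>M) \<le> (\<integral>\<^sup>+\<omega>. ennreal (?D \<omega> + 2 * \<tau> * ?W \<omega>) \<partial>M)"
  proof (intro nn_integral_mono ennreal_leI)
    fix \<omega> assume "\<omega> \<in> space M"
    from cavs_est_dist_sample_mean_le[OF this]
    show "\<bar>cavs_est n Y G \<omega> - \<theta>\<bar> \<le> ?D \<omega> + 2 * \<tau> * ?W \<omega>" by linarith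
  qed
  also have "\<dots> = ennreal (expectation (\<lambda>\<omega>. ?D \<omega> + 2 * \<tau> * ?W \<omega>))"
    using bounds nonneg by (intro nn_integral_eq_integral) auto
  also have "expectation (\<lambda>\<omega>. ?D \<omega> + 2 * \<tau> * ?W \<omega>) = expectation ?D + 2 * \<tau> * expectation ?W"
    using bounds by (subst Bochner_Integration.integral_add) auto
  also have "\<dots> \<le> (1 + 2 * \<tau>) * sqrt (\<sigma>2 / real n)"
    unfolding distrib_right mult_1_left
    using bounds tau_pos by (intro add_mono mult_left_mono) auto
  finally show ?thesis by (simp add: ennreal_leI)
qed

end

theorem theorem2p1:
  "(\<forall>(M :: 'a measure) n \<tau> N Y G. cavs M n \<tau> N Y G \<longrightarrow>
      (\<forall>\<omega>\<in>space M.
         \<bar>cavs_est n Y G \<omega> - sample_mean n (\<lambda>i. Y i \<omega>)\<bar>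
           \<le> 2 * \<tau> * sqrt (sample_var n (\<lambda>i. Y i \<omega>) / real n))) \<and>
   (\<exists>C>0. \<forall>(M :: 'a measure) n \<tau> N Y G Z \<theta>0 \<sigma>2.
      cavs M n \<tau> N Y G \<longrightarrow>
      iid M n Y \<longrightarrow>
      (\<forall>i\<in>{1..n}. \<forall>\<omega>\<in>space M. Y i \<omega> = \<theta>0 + Z i \<omega>) \<longrightarrow>
      integrable M (Y 1) \<longrightarrow>
      \<theta>0 = integral\<^sup>L M (Y 1) \<longrightarrow>
      integrable M (\<lambda>\<omega>. \<bar>Z 1 \<omega>\<bar>\<^sup>2) \<longrightarrow>
      \<sigma>2 = (\<integral>\<omega>. \<bar>Z 1 \<omega>\<bar>\<^sup>2 \<partial>M) \<longrightarrow>
      (\<integral>\<^sup>+\<omega>. ennreal \<bar>cavs_est n Y G \<omega> - \<theta>0\<bar> \<partial>M)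
        \<le> ennreal (C * max 1 \<tau> * sqrt (\<sigma>2 / real n)))"
proof (intro conjI allI impI ballI)
  fix M :: "'a measure" and n \<tau> N Y G \<omega>
  assume "cavs M n \<tau> N Y G" and "\<omega> \<in> space M"
  then show "\<bar>cavs_est n Y G \<omega> - sample_mean n (\<lambda>i. Y i \<omega>)\<bar>
      \<le> 2 * \<tau> * sqrt (sample_var n (\<lambda>i. Y i \<omega>) / real n)"
    by (rule cavs.cavs_est_dist_sample_mean_le)
next
  show "\<exists>C>0. \<forall>(M :: 'a measure) n \<tau> N Y G Z \<theta>0 \<sigma>2.
      cavs M n \<tau> N Y G \<longrightarrow>
      iid M n Y \<longrightarrow>
      (\<forall>i\<in>{1..n}. \<forall>\<omega>\<in>space M. Y i \<omega> = \<theta>0 + Z i \<omega>) \<longrightarrow>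
      integrable M (Y 1) \<longrightarrow>
      \<theta>0 = integral\<^sup>L M (Y 1) \<longrightarrow>
      integrable M (\<lambda>\<omega>. \<bar>Z 1 \<omega>\<bar>\<^sup>2) \<longrightarrow>
      \<sigma>2 = (\<integral>\<omega>. \<bar>Z 1 \<omega>\<bar>\<^sup>2 \<partial>M) \<longrightarrow>
      (\<integral>\<^sup>+\<omega>. ennreal \<bar>cavs_est n Y G \<omega> - \<theta>0\<bar> \<partial>M)
        \<le> ennreal (C * max 1 \<tau> * sqrt (\<sigma>2 / real n))"
  proof (intro exI[of _ 3] conjI allI impI)
    fix M :: "'a measure" and n \<tau> N and Y :: "nat \<Rightarrow> 'a \<Rightarrow> real" and G
      and Z :: "nat \<Rightarrow> 'a \<Rightarrow> real" and \<theta>0 \<sigma>2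
    assume cavs: "cavs M n \<tau> N Y G" and iid: "iid M n Y"
      and Z: "\<forall>i\<in>{1..n}. \<forall>\<omega>\<in>space M. Y i \<omega> = \<theta>0 + Z i \<omega>"
      and int: "integrable M (Y 1)" and \<theta>0: "\<theta>0 = integral\<^sup>L M (Y 1)"
      and sq: "integrable M (\<lambda>\<omega>. \<bar>Z 1 \<omega>\<bar>\<^sup>2)" and \<sigma>2: "\<sigma>2 = (\<integral>\<omega>. \<bar>Z 1 \<omega>\<bar>\<^sup>2 \<partial>M)"
    interpret cavs M n \<tau> N Y G by fact
    have Z1: "\<bar>Z 1 \<omega>\<bar>\<^sup>2 = (Y 1 \<omega> - \<theta>0)\<^sup>2" if "\<omega> \<in> space M" for \<omega>
      using Z n_ge_1 that by simp
    have sq': "integrable M (\<lambda>\<omega>. (Y 1 \<omega> - \<theta>0)\<^sup>2)"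
      using sq by (subst Bochner_Integration.integrable_cong[OF refl Z1[symmetric]])
    have \<sigma>2': "\<sigma>2 = expectation (\<lambda>\<omega>. (Y 1 \<omega> - \<theta>0)\<^sup>2)"
      unfolding \<sigma>2 by (rule Bochner_Integration.integral_cong[OF refl Z1])
    have "0 \<le> \<sigma>2" by (simp add: \<sigma>2)
    have "(\<integral>\<^sup>+\<omega>. ennreal \<bar>cavs_est n Y G \<omega> - \<theta>0\<bar> \<partial>M) \<le> ennreal ((1 + 2 * \<tau>) * sqrt (\<sigma>2 / real n))"
      by (rule cavs_est_mean_error_le[OF iid int \<theta>0 sq' \<sigma>2'])
    also have "\<dots> \<le> ennreal (3 * max 1 \<tau> * sqrt (\<sigma>2 / real n))"
      using \<open>0 \<le> \<sigma>2\<close> by (intro ennreal_leI mult_right_mono) auto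
    finally show "(\<integral>\<^sup>+\<omega>. ennreal \<bar>cavs_est n Y G \<omega> - \<theta>0\<bar> \<partial>M)
        \<le> ennreal (3 * max 1 \<tau> * sqrt (\<sigma>2 / real n))" .
  qed simp
qed

end
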